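(* Let $G=(V,E)$ be a finite graph, $A\subseteq V$, and $c:A\to[k]$ a partial coloring. Let $A_1,A_2,\dots,A_k$ be the partition of $A$ into color classes of $c$ (i.e. $A_i=c^{-1}(i)$). For every integer $m\ge k$, the number $(-1)^{|V\setminus A|}\chi_{G,c}(-m)$ equals the number of pairs $(\widehat c,\sigma)$, where $\widehat c:V\to[m]$ is a (not necessarily proper) coloring extending $c$ and $\sigma$ is an acyclic orientation of $G$ weakly compatible with $\widehat c$ such that there is no directed path (of positive length) with both endpoints in $A_i$ for some $i\in\{1,\dots,k\}$.
   Context: $[m]=\{1,\dots,m\}$. An $m$-coloring is a map $V\to[m]$; it is proper if adjacent vertices get different colors. An extension of $c$ is a coloring $\widehat c$ with $\widehat c(a)=c(a)$ for all $a\in A$. $\chi_{G,c}$ is the polynomial (which exists) such that for all integers $m\ge k$, $\chi_{G,c}(m)$ equals the number of proper colorings $\widehat c:V\to[m]$ extending $c$ (it is the zero polynomial if there are no proper extensions). An orientation $\sigma$ assigns each edge a head and tail; it is acyclic if there is no directed cycle; it is weakly compatible with a coloring $\widehat c$ if every edge $uv$ with $\widehat c(u)<\widehat c(v)$ is oriented from $u$ to $v$. *)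

theory Defs
  imports "HOL-Computational_Algebra.Polynomial" "HOL-Library.FuncSet"
begin

definition finite_graph :: "'a set \<Rightarrow> 'a set set \<Rightarrow> bool" where
  "finite_graph V E \<longleftrightarrow> finite V \<and> (\<forall>e\<in>E. e \<subseteq> V \<and> card e = 2)"

(* Colorings of V are extensional functions (undefined outside V), so that they can be counted;
   only the values of c on A matter. *)
definition extensions :: "'a set \<Rightarrow> 'a set \<Rightarrow> ('a \<Rightarrow> nat) \<Rightarrow> nat \<Rightarrow> ('a \<Rightarrow> nat) set" where
  "extensions V A c m = {d \<in> V \<rightarrow>\<^sub>E {1..m}. \<forall>a\<in>A. d a = c a}"

definition proper_coloring :: "'a set set \<Rightarrow> ('a \<Rightarrow> nat) \<Rightarrow> bool" where
  "proper_coloring E d \<longleftrightarrow> (\<forall>u v. {u, v} \<in> E \<longrightarrow> d u \<noteq> d v)"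

(* The polynomial is unique, as it is prescribed at infinitely many points; it has integer
   coefficients, as the usual chromatic polynomial does. *)
definition extension_poly ::
  "'a set \<Rightarrow> 'a set set \<Rightarrow> 'a set \<Rightarrow> ('a \<Rightarrow> nat) \<Rightarrow> nat \<Rightarrow> int poly" where
  "extension_poly V E A c k =
     (THE p. \<forall>m\<ge>k. poly p (int m) = int (card {d \<in> extensions V A c m. proper_coloring E d}))"

(* An orientation maps each edge to the pair (tail, head) and is undefined outside E. *)
definition orientations :: "'a set set \<Rightarrow> ('a set \<Rightarrow> 'a \<times> 'a) set" where
  "orientations E = {\<sigma> \<in> extensional E. \<forall>e\<in>E. e = {fst (\<sigma> e), snd (\<sigma> e)}}"

definition acyclic_orientations :: "'a set set \<Rightarrow> ('a set \<Rightarrow> 'a \<times> 'a) set" where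
  "acyclic_orientations E = {\<sigma> \<in> orientations E. acyclic (\<sigma> ` E)}"

definition weakly_compatible ::
  "'a set set \<Rightarrow> ('a \<Rightarrow> nat) \<Rightarrow> ('a set \<Rightarrow> 'a \<times> 'a) \<Rightarrow> bool" where
  "weakly_compatible E d \<sigma> \<longleftrightarrow> (\<forall>u v. {u, v} \<in> E \<and> d u < d v \<longrightarrow> \<sigma> {u, v} = (u, v))"

definition color_class :: "'a set \<Rightarrow> ('a \<Rightarrow> nat) \<Rightarrow> nat \<Rightarrow> 'a set" where
  "color_class A c i = {a \<in> A. c a = i}"

(* There is a directed path of positive length from u to v.  The transitive closure speaks of
   directed walks, but in an acyclic orientation every directed walk is a path. *)
definition directed_path ::
  "'a set set \<Rightarrow> ('a set \<Rightarrow> 'a \<times> 'a) \<Rightarrow> 'a \<Rightarrow> 'a \<Rightarrow> bool" where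
  "directed_path E \<sigma> u v \<longleftrightarrow> (u, v) \<in> (\<sigma> ` E)\<^sup>+"

end

theory Submission
  imports Defs
begin

text \<open>
  Identifying the vertices of each color class \<open>A\<^sub>i\<close> to a single vertex labelled \<open>i\<close>
  turns the path condition into plain acyclicity: along an orientation compatible with a coloring
  the colors are weakly increasing, so a cycle of the quotient stays in one color and hence passes
  through at most one identified vertex.  For the resulting multigraphs, where a vertex is either
  a color or a free vertex, both sides obey the same deletion-contraction recursion up to sign.
  For an edge between equally colored vertices \<open>x\<close> and \<open>y\<close>, an acyclic orientation of the
  remaining edges can be extended in at least one way, and in both ways iff it stays
  acyclic after merging \<open>x\<close> and \<open>y\<close>.
\<close>

section \<open>Acyclicity of quotients\<close>

lemma trancl_map_prod:
  assumes "(p, q) \<in> R\<^sup>+"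
  shows "(g p, g q) \<in> (map_prod g g ` R)\<^sup>+"
  using assms
proof induction
  case (base q)
  then have "(g p, g q) \<in> map_prod g g ` R" by force
  then show ?case by (rule r_into_trancl)
next
  case (step q r)
  then have "(g q, g r) \<in> map_prod g g ` R" by force
  with step show ?case by (meson trancl.trancl_into_trancl)
qed

lemma trancl_mono_fun:
  fixes f :: "'b \<Rightarrow> 'c::preorder"
  assumes "\<And>p q. (p, q) \<in> R \<Longrightarrow> f p \<le> f q" and "(p, q) \<in> R\<^sup>+"
  shows "f p \<le> f q"
  using assms(2)
proof induction
  case (base q)
  then show ?case using assms(1) by blast
next
  case (step q r)
  then show ?case using assms(1) order_trans by blast
qed

lemma rtrancl_mono_fun:
  fixes f :: "'b \<Rightarrow> 'c::preorder"
  assumes "\<And>p q. (p, q) \<in> R \<Longrightarrow> f p \<le> f q" and "(p, q) \<in> R\<^sup>*"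
  shows "f p \<le> f q"
  using assms trancl_mono_fun[of R f p q] by (auto simp: rtrancl_eq_or_trancl)

text \<open>A closed walk of the quotient lifts to an \<open>R\<close>-walk interrupted by jumps
  inside fibres of \<open>g\<close>. Edges never lower \<open>f\<close> and jumps preserve it, so
  \<open>f\<close> is constant along the lift. Then \<open>uniq\<close> puts all jumps into one
  fibre, and some jump-free stretch of positive length joins two points of a common fibre.\<close>

lemma acyclic_quotient_iff:
  fixes f :: "'b \<Rightarrow> 'd::order" and g :: "'b \<Rightarrow> 'c"
  assumes mono: "\<And>p q. (p, q) \<in> R \<Longrightarrow> f p \<le> f q"
    and fib: "\<And>p q. g p = g q \<Longrightarrow> f p = f q"
    and uniq: "\<And>p p' r r'. \<lbrakk>g p = g p'; p \<noteq> p'; g r = g r'; r \<noteq> r'; f p = f r\<rbrakk> \<Longrightarrow> g p = g r"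
  shows "acyclic (map_prod g g ` R) \<longleftrightarrow> (\<forall>p q. g p = g q \<longrightarrow> (p, q) \<notin> R\<^sup>+)"
proof
  assume "acyclic (map_prod g g ` R)"
  then show "\<forall>p q. g p = g q \<longrightarrow> (p, q) \<notin> R\<^sup>+"
    using trancl_map_prod[of _ _ R g] by (metis acyclic_def)
next
  assume no: "\<forall>p q. g p = g q \<longrightarrow> (p, q) \<notin> R\<^sup>+"
  have tmono: "f p \<le> f q" if "(p, q) \<in> R\<^sup>+" for p q
    using trancl_mono_fun[of R f] mono that by blast
  define N where "N s \<longleftrightarrow> (\<exists>s'. g s = g s' \<and> s \<noteq> s')" for s
  \<comment> \<open>Only the parts of a lifted walk before its first jump, from \<open>s\<close>, and after its last
    jump, to \<open>t\<close>, matter.\<close>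
  have lift: "\<exists>p' q'. g p' = p \<and> g q' = q \<and> ((p', q') \<in> R\<^sup>+ \<or>
      (\<exists>s t. N s \<and> N t \<and> f s \<le> f t \<and> (p', s) \<in> R\<^sup>+ \<and> (t, q') \<in> R\<^sup>+))"
    if "(p, q) \<in> (map_prod g g ` R)\<^sup>+" for p q
    using that
  proof induction
    case (base q)
    then show ?case by blast
  next
    case (step q r)
    from step.hyps obtain q2 r' where q2: "g q2 = q" "g r' = r" "(q2, r') \<in> R" by auto
    from step.IH obtain p' q1 where q1: "g p' = p" "g q1 = q"
      and alt: "(p', q1) \<in> R\<^sup>+ \<or>
        (\<exists>s t. N s \<and> N t \<and> f s \<le> f t \<and> (p', s) \<in> R\<^sup>+ \<and> (t, q1) \<in> R\<^sup>+)"
      by blast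
    show ?case
    proof (cases "q1 = q2")
      case True
      then have "(u, q1) \<in> R\<^sup>+ \<Longrightarrow> (u, r') \<in> R\<^sup>+" for u
        using q2 by (simp add: trancl.trancl_into_trancl)
      then show ?thesis using alt q1(1) q2(2) by blast
    next
      \<comment> \<open>A jump from \<open>q1\<close> to \<open>q2\<close>: the last jump now ends
        in \<open>q2\<close>, and if there was no earlier jump, \<open>q1\<close> becomes the start
        \<open>s\<close> of the first one.\<close>
      case False
      then have N: "N q1" "N q2" using q1 q2 unfolding N_def by metis+
      have f: "f q1 = f q2" using fib q1 q2 by metis
      have r: "(q2, r') \<in> R\<^sup>+" using q2 by blast
      show ?thesis using alt
      proof
        assume "(p', q1) \<in> R\<^sup>+"
        then show ?thesis using N f r q1 q2 by (metis order_refl)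
      next
        assume "\<exists>s t. N s \<and> N t \<and> f s \<le> f t \<and> (p', s) \<in> R\<^sup>+ \<and> (t, q1) \<in> R\<^sup>+"
        then obtain s t where st: "N s" "f s \<le> f t" "(p', s) \<in> R\<^sup>+" "(t, q1) \<in> R\<^sup>+"
          by blast
        have "f s \<le> f q2" using st tmono f by (metis order_trans)
        then show ?thesis using st N r q1 q2 by metis
      qed
    qed
  qed
  show "acyclic (map_prod g g ` R)"
    unfolding acyclic_def
  proof (intro allI notI)
    fix p
    assume "(p, p) \<in> (map_prod g g ` R)\<^sup>+"
    from lift[OF this] obtain p' q' where pq: "g p' = p" "g q' = p" and "(p', q') \<in> R\<^sup>+ \<or>
        (\<exists>s t. N s \<and> N t \<and> f s \<le> f t \<and> (p', s) \<in> R\<^sup>+ \<and> (t, q') \<in> R\<^sup>+)"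
      by blast
    moreover have "(p', q') \<notin> R\<^sup>+" using no pq by simp
    ultimately obtain s t where *: "g p' = p" "g q' = p" "N s" "N t" "f s \<le> f t"
      "(p', s) \<in> R\<^sup>+" "(t, q') \<in> R\<^sup>+"
      by blast
    have "f p' = f q'" using * fib by metis
    \<comment> \<open>The chain \<open>f p' \<le> f s \<le> f t \<le> f q' = f p'\<close> collapses
      to equalities.\<close>
    then have eq: "f s = f t" "f p' = f s" using tmono * by (metis order_trans order_antisym)+
    show False
    proof (cases "p' = q'")
      case True
      \<comment> \<open>The stretch after the last jump continues into the one before the first
        jump.\<close>
      then have "(t, s) \<in> R\<^sup>+" using * by (meson trancl_trans)
      moreover have "g t = g s" using *(3,4) eq uniq unfolding N_def by metis
      ultimately show False using no by blast
    next
      case False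
      \<comment> \<open>Here the fibre of \<open>p'\<close> is nontrivial because it also contains
        \<open>q'\<close>, so it is the fibre of \<open>s\<close>, and the stretch from
        \<open>p'\<close> to \<open>s\<close> is forbidden.\<close>
      then have "g p' = g s" using * eq uniq unfolding N_def by metis
      then show False using no * by blast
    qed
  qed
qed

section \<open>Compatible acyclic orientations of multigraphs\<close>

text \<open>A multigraph is a set of edges \<open>E\<close> with end points \<open>h e\<close>; an orientation is given by the
  set \<open>B\<close> of those edges whose end points are swapped.\<close>

definition orient :: "('e \<Rightarrow> 'b \<times> 'b) \<Rightarrow> 'e set \<Rightarrow> 'e \<Rightarrow> 'b \<times> 'b" where
  "orient h B e = (if e \<in> B then prod.swap (h e) else h e)"

text \<open>Weak compatibility phrased through the directed pairs alone, so that it makes sense for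
  multigraphs and can be pulled back along quotient maps.\<close>

definition weakly_increasing :: "('b \<Rightarrow> nat) \<Rightarrow> ('b \<times> 'b) set \<Rightarrow> bool" where
  "weakly_increasing f R \<longleftrightarrow> (\<forall>(p, q)\<in>R. f p \<le> f q)"

definition compatible :: "('b \<Rightarrow> nat) \<Rightarrow> ('e \<Rightarrow> 'b \<times> 'b) \<Rightarrow> 'e set \<Rightarrow> 'e set set" where
  "compatible f h E =
    {B \<in> Pow E. weakly_increasing f (orient h B ` E) \<and> acyclic (orient h B ` E)}"

lemma finite_compatible: "finite E \<Longrightarrow> finite (compatible f h E)"
  by (simp add: compatible_def)

text \<open>A set of swapped edges does not mention vertices, so the same \<open>B\<close> orients a
  multigraph and each of its quotients.\<close>

lemma orient_map_prod: "orient (map_prod g g \<circ> h) B ` E = map_prod g g ` orient h B ` E"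
proof -
  have "orient (map_prod g g \<circ> h) B e = map_prod g g (orient h B e)" for e
    by (cases "h e") (simp add: orient_def)
  then show ?thesis by (simp add: image_image)
qed

lemma weakly_increasing_map_prod:
  "weakly_increasing f (map_prod g g ` R) = weakly_increasing (f \<circ> g) R"
  by (auto simp: weakly_increasing_def)

lemma weakly_increasing_insert [simp]:
  "weakly_increasing f (insert (p, q) R) \<longleftrightarrow> f p \<le> f q \<and> weakly_increasing f R"
  by (simp add: weakly_increasing_def)

lemma weakly_increasing_rtrancl:
  "weakly_increasing f R \<Longrightarrow> (p, q) \<in> R\<^sup>* \<Longrightarrow> f p \<le> f q"
  using rtrancl_mono_fun[of R f p q] by (auto simp: weakly_increasing_def)

section \<open>Adding one edge to a multigraph\<close>

lemma compatible_loop: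
  assumes "h e = (x, x)" and "e \<in> E"
  shows "compatible f h E = {}"
proof -
  have "(x, x) \<in> orient h B ` E" for B
    using assms by (force simp: orient_def)
  then have "(x, x) \<in> (orient h B ` E)\<^sup>+" for B
    by (rule r_into_trancl)
  then show ?thesis
    unfolding compatible_def acyclic_def by blast
qed

text \<open>The two sets correspond to the two directions of \<open>e\<close>. A new edge keeps the
  orientation acyclic iff there is no return walk; the reflexive closure makes this correct for
  \<open>x = y\<close> as well, where both sets are empty.\<close>

lemma card_compatible_insert:
  assumes "finite E" and "e \<notin> E" and "h e = (x, y)"
  shows "card (compatible f h (insert e E)) =
    card {B \<in> compatible f h E. f x \<le> f y \<and> (y, x) \<notin> (orient h B ` E)\<^sup>*} +
    card {B \<in> compatible f h E. f y \<le> f x \<and> (x, y) \<notin> (orient h B ` E)\<^sup>*}"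
    (is "_ = card ?S + card ?T")
proof -
  have 1: "orient h B ` insert e E = insert (x, y) (orient h B ` E)" if "B \<subseteq> E" for B
  proof -
    have "e \<notin> B" using that assms(2) by blast
    then have "orient h B e = (x, y)" using assms(3) by (simp add: orient_def)
    then show ?thesis by simp
  qed
  have 2: "orient h (insert e B) ` insert e E = insert (y, x) (orient h B ` E)" for B
  proof -
    have "orient h (insert e B) e = (y, x)" using assms(3) by (simp add: orient_def)
    moreover have "orient h (insert e B) ` E = orient h B ` E"
      using assms(2) by (intro image_cong) (auto simp: orient_def)
    ultimately show ?thesis by simp
  qed
  have "compatible f h (insert e E) = ?S \<union> insert e ` ?T"
  proof (intro set_eqI)
    fix B
    show "B \<in> compatible f h (insert e E) \<longleftrightarrow> B \<in> ?S \<union> insert e ` ?T"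
    proof (cases "e \<in> B")
      case True
      then obtain C where C: "B = insert e C" "e \<notin> C" by (meson Set.set_insert)
      have "B \<in> insert e ` ?T \<longleftrightarrow> C \<in> ?T"
        using C \<open>e \<notin> E\<close> by (auto simp: compatible_def) (metis insert_ident subset_iff)+
      moreover have "B \<notin> ?S" using True \<open>e \<notin> E\<close> by (auto simp: compatible_def)
      moreover have "C \<subseteq> insert e E \<longleftrightarrow> C \<subseteq> E" using C by blast
      ultimately show ?thesis
        using C by (auto simp: compatible_def 2 acyclic_insert simp del: image_insert)
    next
      case False
      then have "B \<subseteq> insert e E \<longleftrightarrow> B \<subseteq> E" by blast
      then show ?thesis
        using False by (auto simp: compatible_def 1 acyclic_insert simp del: image_insert)
    qed
  qed
  moreover have "inj_on (insert e) ?T"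
    using \<open>e \<notin> E\<close> by (auto simp: inj_on_def compatible_def)
  moreover have "?S \<inter> insert e ` ?T = {}"
    using \<open>e \<notin> E\<close> by (auto simp: compatible_def)
  ultimately show ?thesis
    using finite_compatible[OF \<open>finite E\<close>, of f h] by (simp add: card_Un_disjoint card_image)
qed

text \<open>The colors force the direction of \<open>e\<close>, and a return walk would have to
  descend from the larger color to the smaller one. So one of the two sets is everything and the
  other is empty.\<close>

lemma card_compatible_insert_neq:
  assumes "finite E" and "e \<notin> E" and "h e = (x, y)" and "f x \<noteq> f y"
  shows "card (compatible f h (insert e E)) = card (compatible f h E)"
proof -
  let ?P = "\<lambda>x y. {B \<in> compatible f h E. f x \<le> f y \<and> (y, x) \<notin> (orient h B ` E)\<^sup>*}"
  have *: "?P x y = (if f x \<le> f y then compatible f h E else {})" if "f x \<noteq> f y" for x y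
    using that by (auto simp: compatible_def dest: weakly_increasing_rtrancl)
  show ?thesis
    using card_compatible_insert[of E e h x y f] assms(1-3) *[of x y] *[of y x] assms(4)
    by auto
qed

text \<open>Inclusion-exclusion for the two directions of \<open>e\<close>: the union of
  \<open>?S\<close> and \<open>?T\<close> is the deletion term and their intersection is the
  contraction term. By \<open>fib\<close>, \<open>g\<close> identifies \<open>x\<close> with
  \<open>y\<close> and nothing else, leaving open which vertex represents the pair.\<close>

lemma card_compatible_insert_eq:
  assumes "finite E" and "e \<notin> E" and "h e = (x, y)" and "x \<noteq> y" and "f x = f y"
    and fib: "\<And>p q. g p = g q \<longleftrightarrow> p = q \<or> {p, q} = {x, y}" and "f \<circ> g = f"
  shows "card (compatible f h (insert e E)) =
    card (compatible f h E) + card (compatible f (map_prod g g \<circ> h) E)"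
proof -
  let ?S = "{B \<in> compatible f h E. (y, x) \<notin> (orient h B ` E)\<^sup>*}"
  let ?T = "{B \<in> compatible f h E. (x, y) \<notin> (orient h B ` E)\<^sup>*}"
  have ac: "acyclic (map_prod g g ` R) \<longleftrightarrow> acyclic R \<and> (x, y) \<notin> R\<^sup>* \<and> (y, x) \<notin> R\<^sup>*" for R
  proof -
    have "acyclic (map_prod g g ` R) \<longleftrightarrow> (\<forall>p q. g p = g q \<longrightarrow> (p, q) \<notin> R\<^sup>+)"
      \<comment> \<open>A constant \<open>f\<close> suffices, since \<open>{x, y}\<close> is the
        only nontrivial fibre of \<open>g\<close>.\<close>
      by (rule acyclic_quotient_iff[where f = "\<lambda>_. 0::nat"])
        (auto simp: fib doubleton_eq_iff)
    also have "\<dots> \<longleftrightarrow> acyclic R \<and> (x, y) \<notin> R\<^sup>* \<and> (y, x) \<notin> R\<^sup>*"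
      using \<open>x \<noteq> y\<close> by (auto simp: fib doubleton_eq_iff acyclic_def rtrancl_eq_or_trancl)
    finally show ?thesis .
  qed
  have "?S \<union> ?T = compatible f h E"
  proof -
    have "(x, y) \<notin> R\<^sup>* \<or> (y, x) \<notin> R\<^sup>*" if "acyclic R" for R
      using that \<open>x \<noteq> y\<close> by (metis acyclic_def rtrancl_eq_or_trancl trancl_trans)
    then show ?thesis by (auto simp: compatible_def)
  qed
  moreover have "?S \<inter> ?T = compatible f (map_prod g g \<circ> h) E"
    by (auto simp: compatible_def orient_map_prod weakly_increasing_map_prod ac \<open>f \<circ> g = f\<close>)
  moreover have "finite ?S" "finite ?T"
    using finite_compatible[OF \<open>finite E\<close>, of f h] by auto
  ultimately have "card ?S + card ?T =
      card (compatible f h E) + card (compatible f (map_prod g g \<circ> h) E)"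
    using card_Un_Int[of ?S ?T] by simp
  then show ?thesis
    using card_compatible_insert[of E e h x y f] assms(1-3) \<open>f x = f y\<close> by simp
qed

section \<open>Reciprocity for multigraphs with precolored vertices\<close>

text \<open>A vertex \<open>Inl i\<close> is precolored with the color \<open>i\<close>, a vertex \<open>Inr v\<close> is free.\<close>

definition color_of :: "('a \<Rightarrow> nat) \<Rightarrow> nat + 'a \<Rightarrow> nat" where
  "color_of d = case_sum id d"

lemma color_of_simps [simp]: "color_of d (Inl i) = i" "color_of d (Inr v) = d v"
  by (simp_all add: color_of_def)

definition proper_on :: "('b \<Rightarrow> nat) \<Rightarrow> ('e \<Rightarrow> 'b \<times> 'b) \<Rightarrow> 'e set \<Rightarrow> bool" where
  "proper_on f h E \<longleftrightarrow> (\<forall>e\<in>E. f (fst (h e)) \<noteq> f (snd (h e)))"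

text \<open>Giving \<open>v\<close> the color of \<open>z\<close> is the same as reading colors
  after contracting \<open>v\<close> into \<open>z\<close>; this carries conditions on colors
  through a contraction.\<close>

lemma color_of_fun_upd: "color_of (d(v := color_of d z)) = color_of d \<circ> id(Inr v := z)"
  by (auto simp: fun_eq_iff color_of_def split: sum.split)

section \<open>Deletion-contraction at a free vertex\<close>

lemma bij_betw_Collect:
  assumes "bij_betw f A B" and "\<And>x. x \<in> A \<Longrightarrow> P x \<longleftrightarrow> Q (f x)"
  shows "bij_betw f {x \<in> A. P x} {y \<in> B. Q y}"
  using assms unfolding bij_betw_def by (auto simp: inj_on_def)

text \<open>A coloring in which \<open>v\<close> and \<open>z\<close> agree is determined by its
  values off \<open>v\<close>, because \<open>z\<close> itself survives the removal of
  \<open>v\<close>.\<close>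

lemma bij_betw_contract:
  assumes "v \<in> W" and "z \<noteq> Inr v" and "z \<in> Inl ` {1..k} \<union> Inr ` W" and "k \<le> m"
  shows "bij_betw (\<lambda>d. d(v := color_of d z)) ((W - {v}) \<rightarrow>\<^sub>E {1..m})
    {d \<in> W \<rightarrow>\<^sub>E {1..m}. color_of d z = d v}"
proof (rule bij_betw_byWitness[where f' = "\<lambda>d. restrict d (W - {v})"])
  have upd: "color_of (d(v := t)) z = color_of d z" for d t
    using assms(2) by (cases z) auto
  have res: "color_of (restrict d (W - {v})) z = color_of d z" for d
    using assms(2,3) by (cases z) auto
  show "\<forall>d\<in>(W - {v}) \<rightarrow>\<^sub>E {1..m}. restrict (d(v := color_of d z)) (W - {v}) = d"
    by (auto simp: fun_eq_iff PiE_def extensional_def)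
  show "\<forall>d\<in>{d \<in> W \<rightarrow>\<^sub>E {1..m}. color_of d z = d v}.
      (restrict d (W - {v}))(v := color_of (restrict d (W - {v})) z) = d"
    unfolding res by (auto simp: fun_eq_iff PiE_def extensional_def)
  \<comment> \<open>If \<open>z\<close> is precolored, its color is at most \<open>k\<close> and
    hence at most \<open>m\<close>.\<close>
  have "color_of d z \<in> {1..m}" if "d \<in> (W - {v}) \<rightarrow>\<^sub>E {1..m}" for d
    using that assms by (cases z) (auto simp: PiE_def Pi_def)
  then show "(\<lambda>d. d(v := color_of d z)) ` ((W - {v}) \<rightarrow>\<^sub>E {1..m})
      \<subseteq> {d \<in> W \<rightarrow>\<^sub>E {1..m}. color_of d z = d v}"
    using assms(1) upd by (fastforce simp: PiE_def Pi_def extensional_def)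
  show "(\<lambda>d. restrict d (W - {v})) ` {d \<in> W \<rightarrow>\<^sub>E {1..m}. color_of d z = d v}
      \<subseteq> (W - {v}) \<rightarrow>\<^sub>E {1..m}"
    by (auto simp: PiE_def Pi_def)
qed

text \<open>A coloring that is proper without \<open>e\<close> either separates the ends of
  \<open>e\<close>, and stays proper with \<open>e\<close>, or gives both the same color and comes
  from the contraction.\<close>

lemma card_proper_delete_contract:
  fixes h :: "'e \<Rightarrow> (nat + 'a) \<times> (nat + 'a)"
  assumes "finite W" and v: "v \<in> W" "z \<noteq> Inr v" "z \<in> Inl ` {1..k} \<union> Inr ` W" "k \<le> m"
    and e: "h e = (z, Inr v) \<or> h e = (Inr v, z)"
  shows "card {d \<in> W \<rightarrow>\<^sub>E {1..m}. proper_on (color_of d) h E} =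
    card {d \<in> W \<rightarrow>\<^sub>E {1..m}. proper_on (color_of d) h (insert e E)} +
    card {d \<in> (W - {v}) \<rightarrow>\<^sub>E {1..m}.
      proper_on (color_of d) (map_prod (id(Inr v := z)) (id(Inr v := z)) \<circ> h) E}"
    (is "card ?A = card ?B + card ?C")
proof -
  let ?D = "{d \<in> W \<rightarrow>\<^sub>E {1..m}. color_of d z = d v \<and> proper_on (color_of d) h E}"
  have "?A = ?B \<union> ?D" "?B \<inter> ?D = {}"
    using e by (auto simp: proper_on_def)
  moreover have "finite ?B" "finite ?D"
    using \<open>finite W\<close> by (auto simp: finite_PiE)
  ultimately have "card ?A = card ?B + card ?D"
    by (metis (no_types, lifting) card_Un_disjoint)
  moreover have "bij_betw (\<lambda>d. d(v := color_of d z)) ?C ?D"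
  proof -
    let ?u = "\<lambda>d. d(v := color_of d z)"
    have "proper_on (color_of (?u d)) h E \<longleftrightarrow>
        proper_on (color_of d) (map_prod (id(Inr v := z)) (id(Inr v := z)) \<circ> h) E" for d
      unfolding color_of_fun_upd by (simp add: proper_on_def)
    then show ?thesis
      using bij_betw_Collect[OF bij_betw_contract[OF v],
          of _ "\<lambda>d. proper_on (color_of d) h E"] by (simp add: conj_assoc)
  qed
  ultimately show ?thesis by (simp add: bij_betw_same_card)
qed

text \<open>For each coloring, the edge \<open>e\<close> contributes a contraction term exactly when
  \<open>z\<close> and \<open>v\<close> have equal colors. In contrast to the count of proper
  colorings, the contraction is added to the deletion; this is the source of the sign in the
  reciprocity.\<close>

lemma sum_compatible_delete_contract:
  fixes h :: "'e \<Rightarrow> (nat + 'a) \<times> (nat + 'a)"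
  assumes "finite W" and v: "v \<in> W" "z \<noteq> Inr v" "z \<in> Inl ` {1..k} \<union> Inr ` W" "k \<le> m"
    and e: "h e = (z, Inr v) \<or> h e = (Inr v, z)" and E: "finite E" "e \<notin> E"
  shows "(\<Sum>d \<in> W \<rightarrow>\<^sub>E {1..m}. card (compatible (color_of d) h (insert e E))) =
    (\<Sum>d \<in> W \<rightarrow>\<^sub>E {1..m}. card (compatible (color_of d) h E)) +
    (\<Sum>d \<in> (W - {v}) \<rightarrow>\<^sub>E {1..m}.
      card (compatible (color_of d) (map_prod (id(Inr v := z)) (id(Inr v := z)) \<circ> h) E))"
proof -
  let ?g = "id(Inr v := z)"
  let ?D = "{d \<in> W \<rightarrow>\<^sub>E {1..m}. color_of d z = d v}"
  let ?n = "\<lambda>d. card (compatible (color_of d) (map_prod ?g ?g \<circ> h) E)"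
  have fib: "?g p = ?g q \<longleftrightarrow> p = q \<or> {p, q} = {z, Inr v}" for p q
    using v(2) by (auto simp: doubleton_eq_iff)
  have "card (compatible (color_of d) h (insert e E)) =
      card (compatible (color_of d) h E) + (if color_of d z = d v then ?n d else 0)" for d
  proof (cases "color_of d z = d v")
    case True
    then have "color_of d \<circ> ?g = color_of d" by (auto simp: fun_eq_iff)
    moreover have "?g p = ?g q \<longleftrightarrow> p = q \<or> {p, q} = {Inr v, z}" for p q
      using fib[of p q] by (simp add: insert_commute)
    ultimately have "card (compatible (color_of d) h (insert e E)) =
        card (compatible (color_of d) h E) + ?n d"
      using e
    proof (elim disjE)
      assume "h e = (z, Inr v)"
      show ?thesis
        by (rule card_compatible_insert_eq[of E e h z "Inr v"]) (fact | use True v(2) in simp)+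
    next
      assume "h e = (Inr v, z)"
      show ?thesis
        by (rule card_compatible_insert_eq[of E e h "Inr v" z]) (fact | use True v(2) in simp)+
    qed
    then show ?thesis using True by simp
  next
    case False
    then have "card (compatible (color_of d) h (insert e E)) = card (compatible (color_of d) h E)"
      using e
    proof (elim disjE)
      assume "h e = (z, Inr v)"
      with E False show ?thesis by (intro card_compatible_insert_neq) auto
    next
      assume "h e = (Inr v, z)"
      with E False show ?thesis by (intro card_compatible_insert_neq) auto
    qed
    then show ?thesis using False by simp
  qed
  then have "(\<Sum>d \<in> W \<rightarrow>\<^sub>E {1..m}. card (compatible (color_of d) h (insert e E))) =
    (\<Sum>d \<in> W \<rightarrow>\<^sub>E {1..m}. card (compatible (color_of d) h E)) + (\<Sum>d\<in>?D. ?n d)"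
    using \<open>finite W\<close> by (simp add: sum.distrib sum.inter_filter finite_PiE)
  also have "(\<Sum>d\<in>?D. ?n d) = (\<Sum>d \<in> (W - {v}) \<rightarrow>\<^sub>E {1..m}. ?n d)"
  proof -
    have "?n (d(v := color_of d z)) = ?n d" for d
    proof -
      \<comment> \<open>No edge of the contracted multigraph meets \<open>v\<close>, so recoloring
        \<open>v\<close> cannot change the count.\<close>
      have "(color_of d \<circ> ?g) \<circ> ?g = color_of d \<circ> ?g" by (auto simp: fun_eq_iff)
      then show ?thesis
        unfolding color_of_fun_upd
        by (simp add: compatible_def orient_map_prod weakly_increasing_map_prod)
    qed
    then show ?thesis
      using sum.reindex_bij_betw[OF bij_betw_contract[OF v], of ?n] by simp
  qed
  finally show ?thesis .
qed

text \<open>One polynomial is required to have both properties, so that the induction can carry them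
  together. The induction is over the edges, with \<open>h\<close> and \<open>W\<close> arbitrary
  because contraction changes both.\<close>

proposition precolored_reciprocity:
  fixes h :: "'e \<Rightarrow> (nat + 'a) \<times> (nat + 'a)"
  assumes "finite E" and "finite W"
    and "\<And>e. e \<in> E \<Longrightarrow> h e \<in> (Inl ` {1..k} \<union> Inr ` W) \<times> (Inl ` {1..k} \<union> Inr ` W)"
  shows "\<exists>p :: int poly. \<forall>m\<ge>k.
    poly p (int m) = int (card {d \<in> W \<rightarrow>\<^sub>E {1..m}. proper_on (color_of d) h E}) \<and>
    (-1) ^ card W * poly p (- int m) =
      int (\<Sum>d \<in> W \<rightarrow>\<^sub>E {1..m}. card (compatible (color_of d) h E))"
  using assms
proof (induction E arbitrary: h W rule: finite_induct)
  case empty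
  have [simp]: "compatible (color_of d) h {} = {{}}" for d
    by (auto simp: compatible_def weakly_increasing_def acyclic_def)
  \<comment> \<open>Without edges all colorings are proper and each has exactly one orientation, the
    empty one; hence the monomial of degree \<open>card W\<close>.\<close>
  have "(-1) ^ n * (- int m) ^ n = int m ^ n" for m n
    by (simp flip: power_mult_distrib)
  then show ?case
    using empty by (intro exI[of _ "monom 1 (card W)"])
      (auto simp: poly_monom proper_on_def card_PiE)
next
  case (insert e E)
  obtain x y where xy: "h e = (x, y)" by fastforce
  have verts: "x \<in> Inl ` {1..k} \<union> Inr ` W" "y \<in> Inl ` {1..k} \<union> Inr ` W"
    using insert.prems(2)[of e] xy by auto
  have hE: "\<And>e. e \<in> E \<Longrightarrow> h e \<in> (Inl ` {1..k} \<union> Inr ` W) \<times> (Inl ` {1..k} \<union> Inr ` W)"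
    using insert.prems(2) by blast
  obtain p where p: "poly p (int m) = int (card {d \<in> W \<rightarrow>\<^sub>E {1..m}. proper_on (color_of d) h E})"
    "(-1) ^ card W * poly p (- int m) =
      int (\<Sum>d \<in> W \<rightarrow>\<^sub>E {1..m}. card (compatible (color_of d) h E))"
    if "m \<ge> k" for m
    using insert.IH[of W h, OF insert.prems(1) hE] by blast
  consider (loop) "x = y" | (fixed) i j where "x = Inl i" "y = Inl j" "i \<noteq> j"
    | (free) v z where "v \<in> W" "z \<noteq> Inr v" "z \<in> Inl ` {1..k} \<union> Inr ` W"
        "h e = (z, Inr v) \<or> h e = (Inr v, z)"
    using verts xy by (cases x; cases y) blast+
  then show ?case
  proof cases
    case loop
    then have "\<not> proper_on f h (insert e E)" "compatible f h (insert e E) = {}" for f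
      using xy compatible_loop[of h e x "insert e E"] by (auto simp: proper_on_def)
    then show ?thesis by (intro exI[of _ 0]) simp
  next
    case fixed
    then have "proper_on (color_of d) h (insert e E) = proper_on (color_of d) h E"
      "card (compatible (color_of d) h (insert e E)) = card (compatible (color_of d) h E)" for d
      using xy card_compatible_insert_neq[OF insert.hyps, of h x y "color_of d"]
      by (auto simp: proper_on_def)
    then show ?thesis using p by (intro exI[of _ p]) simp
  next
    case (free v z)
    let ?g = "id(Inr v := z)"
    have "(map_prod ?g ?g \<circ> h) e \<in>
        (Inl ` {1..k} \<union> Inr ` (W - {v})) \<times> (Inl ` {1..k} \<union> Inr ` (W - {v}))" if "e \<in> E" for e
      using hE[OF that] free(2,3) by (cases "h e") auto
    then obtain p' where p':
      "poly p' (int m) = int (card {d \<in> (W - {v}) \<rightarrow>\<^sub>E {1..m}.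
        proper_on (color_of d) (map_prod ?g ?g \<circ> h) E})"
      "(-1) ^ card (W - {v}) * poly p' (- int m) = int (\<Sum>d \<in> (W - {v}) \<rightarrow>\<^sub>E {1..m}.
        card (compatible (color_of d) (map_prod ?g ?g \<circ> h) E))"
      if "m \<ge> k" for m
      using insert.IH[of "W - {v}" "map_prod ?g ?g \<circ> h"] insert.prems(1) by blast
    \<comment> \<open>Contraction uses up one free vertex, which flips the sign of the
      \<open>p'\<close> term and turns the subtraction in \<open>p - p'\<close> into an
      addition.\<close>
    have W: "card W = Suc (card (W - {v}))"
      using insert.prems(1) free(1) by (metis card_Suc_Diff1)
    show ?thesis
    proof (intro exI[of _ "p - p'"] allI impI conjI)
      fix m assume m: "m \<ge> k"
      show "poly (p - p') (int m) =
          int (card {d \<in> W \<rightarrow>\<^sub>E {1..m}. proper_on (color_of d) h (insert e E)})"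
        using p(1)[OF m] p'(1)[OF m]
          card_proper_delete_contract[of W v z k m h e E] insert.prems(1) free m
        by simp
      have "(-1) ^ card W * poly (p - p') (- int m) =
          (-1) ^ card W * poly p (- int m) + (-1) ^ card (W - {v}) * poly p' (- int m)"
        unfolding W by (simp add: algebra_simps)
      then show "(-1) ^ card W * poly (p - p') (- int m) =
          int (\<Sum>d \<in> W \<rightarrow>\<^sub>E {1..m}. card (compatible (color_of d) h (insert e E)))"
        using p(2)[OF m] p'(2)[OF m]
          sum_compatible_delete_contract[of W v z k m h e E] insert.prems(1) insert.hyps free m
        by simp
    qed
  qed
qed

section \<open>The quotient by the color classes\<close>

text \<open>Two polynomials with the prescribed values differ by one with infinitely many roots, so
  the definite description is met by \<open>p\<close> alone.\<close>

lemma extension_poly_eqI: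
  assumes "\<And>m. m \<ge> k \<Longrightarrow>
    poly p (int m) = int (card {d \<in> extensions V A c m. proper_coloring E d})"
  shows "extension_poly V E A c k = p"
  unfolding extension_poly_def
proof (rule the_equality)
  show "\<forall>m\<ge>k. poly p (int m) = int (card {d \<in> extensions V A c m. proper_coloring E d})"
    using assms by blast
next
  fix q :: "int poly"
  assume q: "\<forall>m\<ge>k. poly q (int m) = int (card {d \<in> extensions V A c m. proper_coloring E d})"
  have "int ` {k..} \<subseteq> {x. poly (q - p) x = 0}"
    using q assms by auto
  moreover have "infinite (int ` {k..})"
    by (simp add: finite_image_iff infinite_Ici)
  ultimately have "infinite {x. poly (q - p) x = 0}"
    using finite_subset by blast
  then show "q = p"
    using poly_roots_finite[of "q - p"] by auto
qed

section \<open>Transfer along the quotient map\<close>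

definition merge_classes :: "'a set \<Rightarrow> ('a \<Rightarrow> nat) \<Rightarrow> 'a \<Rightarrow> nat + 'a" where
  "merge_classes A c u = (if u \<in> A then Inl (c u) else Inr u)"

text \<open>An extension amounts to a free choice of colors on \<open>V - A\<close>; the colors
  prescribed on \<open>A\<close> are legal because \<open>k \<le> m\<close>.\<close>

lemma bij_betw_extensions:
  assumes "A \<subseteq> V" and "c \<in> A \<rightarrow> {1..k}" and "k \<le> m"
  shows "bij_betw (\<lambda>d. restrict (color_of d \<circ> merge_classes A c) V)
    ((V - A) \<rightarrow>\<^sub>E {1..m}) (extensions V A c m)"
proof (rule bij_betw_byWitness[where f' = "\<lambda>d. restrict d (V - A)"])
  show "\<forall>d\<in>(V - A) \<rightarrow>\<^sub>E {1..m}.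
      restrict (restrict (color_of d \<circ> merge_classes A c) V) (V - A) = d"
    by (auto simp: fun_eq_iff PiE_def extensional_def merge_classes_def)
  show "\<forall>d\<in>extensions V A c m.
      restrict (color_of (restrict d (V - A)) \<circ> merge_classes A c) V = d"
    by (auto simp: fun_eq_iff PiE_def extensional_def extensions_def merge_classes_def)
  show "(\<lambda>d. restrict (color_of d \<circ> merge_classes A c) V) ` ((V - A) \<rightarrow>\<^sub>E {1..m})
      \<subseteq> extensions V A c m"
    using assms by (fastforce simp: PiE_def Pi_def extensions_def merge_classes_def)
  show "(\<lambda>d. restrict d (V - A)) ` extensions V A c m \<subseteq> (V - A) \<rightarrow>\<^sub>E {1..m}"
    by (auto simp: extensions_def)
qed

text \<open>With \<open>h\<close> as reference orientation, an orientation is recorded by the edges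
  on which it differs from \<open>h\<close>. By \<open>neq\<close>, swapping an edge really changes
  its direction.\<close>

lemma bij_betw_orientations:
  assumes h: "\<And>e. e \<in> E \<Longrightarrow> e = {fst (h e), snd (h e)}"
    and neq: "\<And>e. e \<in> E \<Longrightarrow> fst (h e) \<noteq> snd (h e)"
  shows "bij_betw (\<lambda>B. restrict (orient h B) E) (Pow E) (orientations E)"
proof (rule bij_betw_byWitness[where f' = "\<lambda>\<sigma>. {e \<in> E. \<sigma> e \<noteq> h e}"])
  have swap: "prod.swap (h e) \<noteq> h e" if "e \<in> E" for e
    using neq[OF that] by (cases "h e") auto
  then show "\<forall>B\<in>Pow E. {e \<in> E. restrict (orient h B) E e \<noteq> h e} = B"
    by (auto simp: orient_def)
  have "\<sigma> e = h e \<or> \<sigma> e = prod.swap (h e)" if "\<sigma> \<in> orientations E" "e \<in> E" for \<sigma> e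
  proof -
    have "{fst (\<sigma> e), snd (\<sigma> e)} = {fst (h e), snd (h e)}"
      using that h[of e] by (auto simp: orientations_def)
    then show ?thesis by (auto simp: doubleton_eq_iff prod_eq_iff)
  qed
  then have "restrict (orient h {e \<in> E. \<sigma> e \<noteq> h e}) E e = \<sigma> e" if "\<sigma> \<in> orientations E" for \<sigma> e
    using that by (cases "e \<in> E")
      (fastforce simp: orient_def, auto simp: orientations_def extensional_def)
  then show "\<forall>\<sigma>\<in>orientations E. restrict (orient h {e \<in> E. \<sigma> e \<noteq> h e}) E = \<sigma>"
    by blast
  show "(\<lambda>B. restrict (orient h B) E) ` Pow E \<subseteq> orientations E"
    using h by (simp add: orientations_def orient_def insert_commute image_subset_iff)
  show "(\<lambda>\<sigma>. {e \<in> E. \<sigma> e \<noteq> h e}) ` orientations E \<subseteq> Pow E"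
    by auto
qed

lemma weakly_compatible_iff:
  assumes "\<sigma> \<in> orientations E"
  shows "weakly_compatible E d \<sigma> \<longleftrightarrow> weakly_increasing d (\<sigma> ` E)"
proof
  assume wc: "weakly_compatible E d \<sigma>"
  have "d u \<le> d v" if uv: "(u, v) \<in> \<sigma> ` E" for u v
  proof (rule ccontr)
    obtain e where e: "e \<in> E" "\<sigma> e = (u, v)" using uv by force
    assume "\<not> d u \<le> d v"
    then have less: "d v < d u" by simp
    have "e = {v, u}" using assms e by (force simp: orientations_def)
    then have vu: "{v, u} \<in> E" "\<sigma> {v, u} = (u, v)" using e by auto
    have "\<sigma> {v, u} = (v, u)"
      using wc[unfolded weakly_compatible_def, THEN spec, THEN spec, THEN mp, OF conjI, OF vu(1) less] .
    from trans[OF sym[OF this] vu(2)] have "v = u" by (rule Pair_inject)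
    then show False using less by simp
  qed
  then show "weakly_increasing d (\<sigma> ` E)"
    unfolding weakly_increasing_def by blast
next
  assume wi: "weakly_increasing d (\<sigma> ` E)"
  show "weakly_compatible E d \<sigma>"
    unfolding weakly_compatible_def
  proof (intro allI impI, elim conjE)
    fix u v
    assume uv: "{u, v} \<in> E" "d u < d v"
    obtain p q where pq: "\<sigma> {u, v} = (p, q)" by fastforce
    then have "{u, v} = {p, q}" using assms uv(1) by (force simp: orientations_def)
    moreover have "d p \<le> d q" using wi uv(1) pq by (force simp: weakly_increasing_def)
    ultimately show "\<sigma> {u, v} = (u, v)" using pq uv(2) by (auto simp: doubleton_eq_iff)
  qed
qed

text \<open>Only vertices of \<open>A\<close> are identified, so each color has at most one
  nontrivial fibre, its color class, and the quotient criterion applies with the color as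
  \<open>f\<close>. Pairs with \<open>p = q\<close> give acyclicity of \<open>R\<close>, the others
  the path condition.\<close>

lemma acyclic_merge_classes_iff:
  assumes "weakly_increasing (color_of d \<circ> merge_classes A c) R" and "c \<in> A \<rightarrow> {1..k}"
  shows "acyclic (map_prod (merge_classes A c) (merge_classes A c) ` R) \<longleftrightarrow>
    acyclic R \<and> \<not> (\<exists>i\<in>{1..k}. \<exists>u\<in>color_class A c i. \<exists>v\<in>color_class A c i. (u, v) \<in> R\<^sup>+)"
proof -
  have fib: "merge_classes A c p = merge_classes A c q \<longleftrightarrow> p = q \<or> p \<in> A \<and> q \<in> A \<and> c p = c q"
    for p q by (auto simp: merge_classes_def)
  have "acyclic (map_prod (merge_classes A c) (merge_classes A c) ` R) \<longleftrightarrow>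
      (\<forall>p q. merge_classes A c p = merge_classes A c q \<longrightarrow> (p, q) \<notin> R\<^sup>+)"
  proof (rule acyclic_quotient_iff[where f = "color_of d \<circ> merge_classes A c"])
    fix p p' r r'
    assume "merge_classes A c p = merge_classes A c p'" "p \<noteq> p'"
      "merge_classes A c r = merge_classes A c r'" "r \<noteq> r'"
      "(color_of d \<circ> merge_classes A c) p = (color_of d \<circ> merge_classes A c) r"
    then show "merge_classes A c p = merge_classes A c r"
      by (auto simp: fib) (auto simp: merge_classes_def)
  qed (use assms(1) in \<open>auto simp: weakly_increasing_def\<close>)
  also have "\<dots> \<longleftrightarrow>
    acyclic R \<and> \<not> (\<exists>i\<in>{1..k}. \<exists>u\<in>color_class A c i. \<exists>v\<in>color_class A c i. (u, v) \<in> R\<^sup>+)"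
  proof -
    \<comment> \<open>The range of \<open>i\<close> loses nothing, since \<open>c\<close> takes
      values in \<open>{1..k}\<close> on \<open>A\<close>.\<close>
    have "(\<exists>i\<in>{1..k}. \<exists>u\<in>color_class A c i. \<exists>v\<in>color_class A c i. (u, v) \<in> R\<^sup>+) \<longleftrightarrow>
        (\<exists>u v. u \<in> A \<and> v \<in> A \<and> c u = c v \<and> (u, v) \<in> R\<^sup>+)"
      using funcset_mem[OF assms(2)] by (force simp: color_class_def)
    then show ?thesis unfolding fib acyclic_def by auto
  qed
  finally show ?thesis .
qed

theorem theorem4p2:
  fixes V A :: "'a set" and E :: "'a set set" and c :: "'a \<Rightarrow> nat" and k m :: nat
  assumes "finite_graph V E"
    and "A \<subseteq> V"
    and "c \<in> A \<rightarrow> {1..k}"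
    and "m \<ge> k"
  shows "(-1) ^ card (V - A) * poly (extension_poly V E A c k) (- int m) =
    int (card {(d, \<sigma>). d \<in> extensions V A c m \<and> \<sigma> \<in> acyclic_orientations E \<and>
      weakly_compatible E d \<sigma> \<and>
      \<not> (\<exists>i\<in>{1..k}. \<exists>u\<in>color_class A c i. \<exists>v\<in>color_class A c i. directed_path E \<sigma> u v)})"
proof -
  let ?q = "merge_classes A c"
  let ?D = "\<lambda>m. (V - A) \<rightarrow>\<^sub>E {1..m}"
  define \<phi> where "\<phi> d = restrict (color_of d \<circ> ?q) V" for d
  define S where "S d = {\<sigma> \<in> acyclic_orientations E. weakly_compatible E d \<sigma> \<and>
      \<not> (\<exists>i\<in>{1..k}. \<exists>u\<in>color_class A c i. \<exists>v\<in>color_class A c i. directed_path E \<sigma> u v)}" for d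
  have fin: "finite V" "finite E"
    using assms(1) finite_subset[of E "Pow V"] by (auto simp: finite_graph_def)
  have "\<forall>e\<in>E. \<exists>p. e = {fst p, snd p} \<and> fst p \<noteq> snd p"
    using assms(1) by (auto simp: finite_graph_def card_2_iff)
  \<comment> \<open>An arbitrary reference direction of each edge presents the graph as a
    multigraph.\<close>
  then obtain h where h: "e = {fst (h e), snd (h e)}" "fst (h e) \<noteq> snd (h e)" if "e \<in> E" for e
    by metis
  have hV: "fst (h e) \<in> V" "snd (h e) \<in> V" if "e \<in> E" for e
    using assms(1) h(1)[OF that] that unfolding finite_graph_def by blast+
  have or: "bij_betw (\<lambda>B. restrict (orient h B) E) (Pow E) (orientations E)"
    using h by (rule bij_betw_orientations)
  have "(map_prod ?q ?q \<circ> h) e \<in>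
      (Inl ` {1..k} \<union> Inr ` (V - A)) \<times> (Inl ` {1..k} \<union> Inr ` (V - A))" if "e \<in> E" for e
    using hV[OF that] assms(3) by (cases "h e") (auto simp: merge_classes_def)
  then obtain p where p:
    "poly p (int m) = int (card {d \<in> ?D m. proper_on (color_of d) (map_prod ?q ?q \<circ> h) E})"
    "(-1) ^ card (V - A) * poly p (- int m) =
      int (\<Sum>d\<in>?D m. card (compatible (color_of d) (map_prod ?q ?q \<circ> h) E))"
    if "m \<ge> k" for m
    using precolored_reciprocity[of E "V - A" "map_prod ?q ?q \<circ> h" k] fin by blast
  have \<phi>: "bij_betw \<phi> (?D m) (extensions V A c m)" if "m \<ge> k" for m
    using bij_betw_extensions[OF assms(2,3) that] by (simp add: \<phi>_def[abs_def])
  \<comment> \<open>Proper extensions correspond under \<open>\<phi>\<close> to proper colorings of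
    the quotient, which \<open>p\<close> counts.\<close>
  have "extension_poly V E A c k = p"
  proof (rule extension_poly_eqI)
    fix m assume m: "m \<ge> k"
    have "proper_coloring E f \<longleftrightarrow> proper_on f h E" for f
    proof -
      have "f (fst (h e)) \<noteq> f (snd (h e)) \<longleftrightarrow> (\<forall>u v. e = {u, v} \<longrightarrow> f u \<noteq> f v)" if "e \<in> E" for e
        by (subst (3) h(1)[OF that]) (auto simp: doubleton_eq_iff)
      then show ?thesis unfolding proper_coloring_def proper_on_def by blast
    qed
    then have "proper_coloring E (\<phi> d) \<longleftrightarrow> proper_on (color_of d) (map_prod ?q ?q \<circ> h) E" for d
      using hV by (simp add: proper_on_def \<phi>_def)
    then have "bij_betw \<phi> {d \<in> ?D m. proper_on (color_of d) (map_prod ?q ?q \<circ> h) E}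
        {d \<in> extensions V A c m. proper_coloring E d}"
      using bij_betw_Collect[OF \<phi>[OF m], of _ "proper_coloring E"] by simp
    then show "poly p (int m) = int (card {d \<in> extensions V A c m. proper_coloring E d})"
      using p(1)[OF m] by (simp add: bij_betw_same_card)
  qed
  moreover have "card (S (\<phi> d)) = card (compatible (color_of d) (map_prod ?q ?q \<circ> h) E)" for d
  proof -
    have "restrict (orient h B) E \<in> S (\<phi> d) \<longleftrightarrow>
        B \<in> compatible (color_of d) (map_prod ?q ?q \<circ> h) E" if "B \<in> Pow E" for B
    proof -
      let ?\<sigma> = "restrict (orient h B) E"
      have \<sigma>: "?\<sigma> \<in> orientations E" using or that unfolding bij_betw_def by blast
      have im: "?\<sigma> ` E = orient h B ` E" by auto
      \<comment> \<open>\<open>\<phi> d\<close> follows the quotient coloring only on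
        \<open>V\<close>, so the end points must be known to lie there.\<close>
      have V: "u \<in> V \<and> v \<in> V" if "(u, v) \<in> orient h B ` E" for u v
        using that hV by (auto simp: orient_def prod_eq_iff split: if_splits)
      have "\<phi> d u \<le> \<phi> d v \<longleftrightarrow> (color_of d \<circ> ?q) u \<le> (color_of d \<circ> ?q) v"
        if "(u, v) \<in> orient h B ` E" for u v
        using V[OF that] by (simp add: \<phi>_def)
      then have "weakly_compatible E (\<phi> d) ?\<sigma> \<longleftrightarrow>
          weakly_increasing (color_of d \<circ> ?q) (orient h B ` E)"
        unfolding weakly_compatible_iff[OF \<sigma>] im weakly_increasing_def by blast
      then show ?thesis
        using \<sigma> that acyclic_merge_classes_iff[OF _ assms(3), of d "orient h B ` E"]
        unfolding S_def acyclic_orientations_def compatible_def directed_path_def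
          orient_map_prod weakly_increasing_map_prod im
        by auto
    qed
    then have "bij_betw (\<lambda>B. restrict (orient h B) E)
        {B \<in> Pow E. B \<in> compatible (color_of d) (map_prod ?q ?q \<circ> h) E}
        {\<sigma> \<in> orientations E. \<sigma> \<in> S (\<phi> d)}"
      by (intro bij_betw_Collect[OF or]) simp
    moreover have "{\<sigma> \<in> orientations E. \<sigma> \<in> S (\<phi> d)} = S (\<phi> d)"
      by (auto simp: S_def acyclic_orientations_def)
    moreover have "{B \<in> Pow E. B \<in> compatible (color_of d) (map_prod ?q ?q \<circ> h) E} =
        compatible (color_of d) (map_prod ?q ?q \<circ> h) E"
      by (auto simp: compatible_def)
    ultimately have "bij_betw (\<lambda>B. restrict (orient h B) E)
        (compatible (color_of d) (map_prod ?q ?q \<circ> h) E) (S (\<phi> d))"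
      by simp
    then show ?thesis by (simp add: bij_betw_same_card)
  qed
  \<comment> \<open>The pairs are counted coloring by coloring, and the colorings are reindexed by
    their free parts.\<close>
  moreover have "card (Sigma (extensions V A c m) S) = (\<Sum>d\<in>?D m. card (S (\<phi> d)))"
  proof -
    have "finite (S d)" for d
    proof -
      have "finite (orientations E)" using bij_betw_finite[OF or] fin by simp
      then show ?thesis by (simp add: S_def acyclic_orientations_def)
    qed
    moreover have "finite (extensions V A c m)"
      using fin by (simp add: extensions_def finite_PiE)
    ultimately show ?thesis
      using sum.reindex_bij_betw[OF \<phi>[OF assms(4)], of "\<lambda>d. card (S d)"] by simp
  qed
  moreover have "{(d, \<sigma>). d \<in> extensions V A c m \<and> \<sigma> \<in> acyclic_orientations E \<and>
      weakly_compatible E d \<sigma> \<and>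
      \<not> (\<exists>i\<in>{1..k}. \<exists>u\<in>color_class A c i. \<exists>v\<in>color_class A c i. directed_path E \<sigma> u v)} =
      Sigma (extensions V A c m) S"
    by (auto simp: S_def)
  ultimately show ?thesis
    using p(2)[OF assms(4)] by simp
qed

end
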